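(* Let $\mathcal{M}$ be an interactive mechanism answering linear queries that is $(\varepsilon,0,\kappa)$-partial differentially private and $(\alpha,\beta)$-sample accurate. Then for every data distribution $\mathcal{P}$, every adversary $\mathcal{A}$, and every $\eta>0$, $$\Pr_{S\sim\mathcal{P}^m,\ \Pi\sim I(\mathcal{M},\mathcal{A};S)}\left[\max_t|a_t-q_t(\mathcal{P}^m)|>\alpha+\sqrt{\frac{2\ln(2/\eta)}{m}}+(e^\varepsilon-1)+\frac{\kappa}{m}\right]\le\beta+\eta.$$
   Context: Setting. A dataset $S\in\mathcal{X}^m$ is held by a mechanism $\mathcal{M}$, where $\mathcal{X}$ is countable. An adversary $\mathcal{A}$ adaptively issues linear queries $q_t$ and $\mathcal{M}$ answers $a_t$. The transcript $\Pi$ takes values in $\mathbf{\Pi}$, with distribution $I(\mathcal{M},\mathcal{A};S)$. Linear queries. A linear query is $q(S)=\frac1m\sum_iq_i(S_i)$ with $q_i:\mathcal{X}\to[0,1]$. Write $q(\mathcal{P}^m)=\mathbb{E}_{S\sim\mathcal{P}^m}q(S)$. Partial differential privacy. $(\varepsilon,\delta,\kappa)$-partial DP means there is $f_L:\mathbf{\Pi}\to2^{[m]}$ with $\max_\pi|f_L(\pi)|\le\kappa$ such that, for every $\mathcal{A}$, every index $i$, every $S,S'$ differing only at $i$, and every event $E$ with $i\notin\bigcup_{\pi\in E}f_L(\pi)$, $$\Pr_{I(\mathcal{M},\mathcal{A};S)}[\Pi\in E]\le e^\varepsilon\Pr_{I(\mathcal{M},\mathcal{A};S')}[\Pi\in E]+\delta.$$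 Here $\delta=0$. Sample accuracy. $(\alpha,\beta)$-sample accurate means $$\Pr_{S\sim\mathcal{P}^m,\ \Pi\sim I(\mathcal{M},\mathcal{A};S)}[\max_t|a_t-q_t(S)|\ge\alpha]\le\beta.$$ *)

theory Defs
  imports "HOL-Probability.Probability"
begin

section \<open>Datasets and linear queries\<close>

text \<open>
  The index set $[m]$ is the finite type \<^typ>\<open>'n\<close>, so $m$ is \<open>CARD('n)\<close> and a dataset
  is a function \<^typ>\<open>'n \<Rightarrow> 'x\<close>. Data distributions are of type \<^typ>\<open>'x pmf\<close>, where
  \<^typ>\<open>'x\<close> is countable.
\<close>

type_synonym ('n, 'x) dataset = "'n \<Rightarrow> 'x"
type_synonym ('n, 'x) query = "'n \<Rightarrow> 'x \<Rightarrow> real"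
type_synonym ('n, 'x) transcript = "nat \<Rightarrow> ('n, 'x) query \<times> real"

definition iid_sample :: "'x pmf \<Rightarrow> ('n::finite, 'x) dataset pmf" where
  "iid_sample P = Pi_pmf UNIV undefined (\<lambda>_. P)"

text \<open>The families $(q_i)_i$ of functions with values in $[0,1]$, with the product Borel algebra.\<close>

definition query_space :: "('n, 'x) query measure" where
  "query_space = PiM UNIV (\<lambda>_. PiM UNIV (\<lambda>_. restrict_space borel {0..1}))"

definition query_value :: "('n::finite, 'x) query \<Rightarrow> ('n, 'x) dataset \<Rightarrow> real" where
  "query_value q S = (1 / real CARD('n)) * (\<Sum>i\<in>UNIV. q i (S i))"

definition query_mean :: "('n::finite, 'x) query \<Rightarrow> 'x pmf \<Rightarrow> real" where
  "query_mean q P = measure_pmf.expectation (iid_sample P) (\<lambda>S. query_value q S)"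


section \<open>Interaction of a mechanism with an adversary\<close>

text \<open>
  A transcript of \<open>k\<close> rounds lists the pairs of query and answer of the rounds \<open>t < k\<close>;
  it is \<^term>\<open>undefined\<close> outside \<open>{..<k}\<close>.
\<close>

definition transcript_space :: "nat \<Rightarrow> ('n, 'x) transcript measure" where
  "transcript_space k = PiM {..<k} (\<lambda>_. query_space \<Otimes>\<^sub>M borel)"

text \<open>
  A mechanism draws an initial state from the dataset; given its state and a query it draws
  its next state and an answer. The state may record the dataset, the history, and coins that
  do not appear in the transcript.
\<close>

record ('n, 'x, 's) mechanism =
  states :: "'s measure"
  init :: "('n, 'x) dataset \<Rightarrow> 's measure"
  respond :: "'s \<times> ('n, 'x) query \<Rightarrow> ('s \<times> real) measure"

definition mechanism :: "('n, 'x, 's) mechanism \<Rightarrow> bool" where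
  "mechanism M \<longleftrightarrow>
     (\<forall>S. init M S \<in> space (prob_algebra (states M))) \<and>
     respond M \<in> (states M \<Otimes>\<^sub>M query_space) \<rightarrow>\<^sub>M prob_algebra (states M \<Otimes>\<^sub>M borel)"

text \<open>
  An adversary draws the query of round \<open>t\<close> from the transcript of the preceding rounds.
  Since the space of queries is standard Borel (\<^typ>\<open>'x\<close> is countable), private coins that
  persist over rounds would induce no further transcript distributions.
\<close>

type_synonym ('n, 'x) adversary = "nat \<Rightarrow> ('n, 'x) transcript \<Rightarrow> ('n, 'x) query measure"

definition adversary :: "('n, 'x) adversary \<Rightarrow> bool" where
  "adversary A \<longleftrightarrow> (\<forall>t. A t \<in> transcript_space t \<rightarrow>\<^sub>M prob_algebra query_space)"

primrec run :: "('n, 'x, 's) mechanism \<Rightarrow> ('n, 'x) adversary \<Rightarrow> ('n, 'x) dataset \<Rightarrow> nat \<Rightarrow>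
    (('n, 'x) transcript \<times> 's) measure" where
  "run M A S 0 =
     do {s \<leftarrow> init M S;
         return (transcript_space 0 \<Otimes>\<^sub>M states M) (\<lambda>_. undefined, s)}"
| "run M A S (Suc t) =
     do {(h, s) \<leftarrow> run M A S t;
         q \<leftarrow> A t h;
         (s', a) \<leftarrow> respond M (s, q);
         return (transcript_space (Suc t) \<Otimes>\<^sub>M states M) (h(t := (q, a)), s')}"

text \<open>$I(\mathcal{M},\mathcal{A};S)$ for \<open>k\<close> rounds.\<close>

definition interaction :: "nat \<Rightarrow> ('n, 'x, 's) mechanism \<Rightarrow> ('n, 'x) adversary \<Rightarrow>
    ('n, 'x) dataset \<Rightarrow> ('n, 'x) transcript measure" where
  "interaction k M A S = distr (run M A S k) (transcript_space k) fst"

text \<open>The joint law of $S\sim\mathcal{P}^m$ and $\Pi\sim I(\mathcal{M},\mathcal{A};S)$.\<close>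

definition sample_interaction :: "nat \<Rightarrow> ('n::finite, 'x, 's) mechanism \<Rightarrow> ('n, 'x) adversary \<Rightarrow>
    'x pmf \<Rightarrow> (('n, 'x) dataset \<times> ('n, 'x) transcript) measure" where
  "sample_interaction k M A P =
     do {S \<leftarrow> measure_pmf (iid_sample P);
         \<pi> \<leftarrow> interaction k M A S;
         return (count_space UNIV \<Otimes>\<^sub>M transcript_space k) (S, \<pi>)}"

definition max_error :: "nat \<Rightarrow> (('n, 'x) query \<Rightarrow> real) \<Rightarrow> ('n, 'x) transcript \<Rightarrow> real" where
  "max_error k v \<pi> = (MAX t\<in>{..<k}. \<bar>snd (\<pi> t) - v (fst (\<pi> t))\<bar>)"


section \<open>Partial differential privacy and sample accuracy\<close>

text \<open>
  Events are measurable sets of transcripts, and accordingly \<open>fL\<close> is required to be measurable.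
  Without this, a partition of the transcript space into non-measurable sets of full outer
  measure would make every mechanism partially private with \<open>\<kappa> = 1\<close>, as no event of positive
  probability would avoid any index.
\<close>

definition partial_dp :: "nat \<Rightarrow> real \<Rightarrow> real \<Rightarrow> real \<Rightarrow> ('n::finite, 'x, 's) mechanism \<Rightarrow> bool" where
  "partial_dp k \<epsilon> \<delta> \<kappa> M \<longleftrightarrow>
     (\<exists>fL :: ('n, 'x) transcript \<Rightarrow> 'n set.
        fL \<in> transcript_space k \<rightarrow>\<^sub>M count_space UNIV \<and>
        (\<forall>\<pi>\<in>space (transcript_space k). real (card (fL \<pi>)) \<le> \<kappa>) \<and>
        (\<forall>A i S S' E. adversary A \<longrightarrow> (\<forall>j. j \<noteq> i \<longrightarrow> S j = S' j) \<longrightarrow>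
           E \<in> sets (transcript_space k) \<longrightarrow> i \<notin> (\<Union>\<pi>\<in>E. fL \<pi>) \<longrightarrow>
           measure (interaction k M A S) E \<le> exp \<epsilon> * measure (interaction k M A S') E + \<delta>))"

definition sample_accurate :: "nat \<Rightarrow> real \<Rightarrow> real \<Rightarrow> ('n::finite, 'x, 's) mechanism \<Rightarrow> bool" where
  "sample_accurate k \<alpha> \<beta> M \<longleftrightarrow>
     (\<forall>P A. adversary A \<longrightarrow>
        measure (sample_interaction k M A P)
          {(S, \<pi>) \<in> space (sample_interaction k M A P).
             max_error k (\<lambda>q. query_value q S) \<pi> \<ge> \<alpha>} \<le> \<beta>)"


section \<open>Well-definedness\<close>

text \<open>
  The Giry bind and the measure of a set are total functions, so the definitions above are
  meaningful only if the kernels, and the events whose probability is taken, are measurable.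
\<close>

lemma measurable_query_component:
  "(\<lambda>q. q i x) \<in> borel_measurable (query_space :: ('n, 'x) query measure)"
proof -
  have "(\<lambda>q. q i x) \<in> (query_space :: ('n, 'x) query measure) \<rightarrow>\<^sub>M restrict_space borel {0..1}"
    unfolding query_space_def
    by (rule measurable_compose[OF measurable_component_singleton[of i UNIV]])
      (auto intro: measurable_component_singleton)
  then show ?thesis by (simp add: measurable_restrict_space2_iff)
qed

lemma measurable_transcript_upd:
  "(\<lambda>(h, q, a). h(t := (q, a)))
     \<in> transcript_space t \<Otimes>\<^sub>M (query_space \<Otimes>\<^sub>M borel) \<rightarrow>\<^sub>M transcript_space (Suc t)"
  unfolding case_prod_unfold prod.collapse transcript_space_def
  by (rule measurable_fun_upd[where J = "{..<t}"]) (auto simp: lessThan_Suc)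

lemma run_prob_algebra:
  fixes M :: "('n, 'x, 's) mechanism"
  assumes M: "mechanism M" and A: "adversary A"
  shows "run M A S t \<in> space (prob_algebra (transcript_space t \<Otimes>\<^sub>M states M))"
proof (induction t)
  case 0
  have i: "init M S \<in> space (prob_algebra (states M))" using M by (simp add: mechanism_def)
  have [measurable]: "(\<lambda>_::nat. undefined) \<in> space (transcript_space 0)"
    by (simp add: transcript_space_def space_PiM)
  have "(\<lambda>s. return (transcript_space 0 \<Otimes>\<^sub>M states M) (\<lambda>_. undefined, s))
    \<in> states M \<rightarrow>\<^sub>M prob_algebra (transcript_space 0 \<Otimes>\<^sub>M states M)"
    by measurable
  from measurable_bind_prob_space[OF measurable_const[OF i] this, of "count_space UNIV"]
  show ?case by (auto dest!: measurable_space)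
next
  case (Suc t)
  have [measurable]: "A t \<in> transcript_space t \<rightarrow>\<^sub>M prob_algebra query_space"
    using A by (simp add: adversary_def)
  have [measurable]: "respond M \<in> (states M \<Otimes>\<^sub>M query_space) \<rightarrow>\<^sub>M prob_algebra (states M \<Otimes>\<^sub>M borel)"
    using M by (simp add: mechanism_def)
  have [measurable]: "(\<lambda>w. (f w)(t := (g w, a w))) \<in> N \<rightarrow>\<^sub>M transcript_space (Suc t)"
    if "f \<in> N \<rightarrow>\<^sub>M transcript_space t" "g \<in> N \<rightarrow>\<^sub>M query_space" "a \<in> N \<rightarrow>\<^sub>M borel" for f g a N
    using measurable_compose[OF measurable_Pair[OF that(1) measurable_Pair[OF that(2,3)]]
      measurable_transcript_upd] by simp
  have "(\<lambda>(h, s). A t h \<bind> (\<lambda>q. respond M (s, q) \<bind>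
      (\<lambda>(s', a). return (transcript_space (Suc t) \<Otimes>\<^sub>M states M) (h(t := (q, a)), s'))))
    \<in> (transcript_space t \<Otimes>\<^sub>M states M) \<rightarrow>\<^sub>M prob_algebra (transcript_space (Suc t) \<Otimes>\<^sub>M states M)"
    by measurable
  from measurable_bind_prob_space[OF measurable_const[OF Suc] this, of "count_space UNIV"]
  show ?case by (auto dest!: measurable_space)
qed

lemma interaction_prob_algebra:
  assumes "mechanism M" and "adversary A"
  shows "interaction k M A S \<in> space (prob_algebra (transcript_space k))"
  using run_prob_algebra[OF assms, of S k]
  unfolding interaction_def space_prob_algebra
  by (auto intro!: prob_space.prob_space_distr cong: measurable_cong_sets)

lemma sample_interaction_prob_algebra:
  fixes M :: "('n::finite, 'x::countable, 's) mechanism"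
  assumes "mechanism M" and "adversary A"
  shows "sample_interaction k M A P \<in> space (prob_algebra (count_space UNIV \<Otimes>\<^sub>M transcript_space k))"
proof -
  have P: "measure_pmf (iid_sample P) \<in> space (prob_algebra (count_space UNIV))"
    by (simp add: space_prob_algebra measure_pmf.prob_space_axioms)
  have I: "interaction k M A \<in> count_space UNIV \<rightarrow>\<^sub>M prob_algebra (transcript_space k)"
    using interaction_prob_algebra[OF assms] by (simp add: measurable_count_space_eq1)
  note [measurable] = I
  have "(\<lambda>S. interaction k M A S \<bind> (\<lambda>\<pi>. return (count_space UNIV \<Otimes>\<^sub>M transcript_space k) (S, \<pi>)))
    \<in> count_space UNIV \<rightarrow>\<^sub>M prob_algebra (count_space UNIV \<Otimes>\<^sub>M transcript_space k)"
    by (intro measurable_bind_prob_space2[OF I]) measurable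
  from measurable_bind_prob_space[OF measurable_const[OF P] this, of "count_space UNIV"]
  show ?thesis unfolding sample_interaction_def by (auto dest!: measurable_space)
qed

lemma measurable_query_value:
  "(\<lambda>q. query_value q S) \<in> borel_measurable query_space"
  unfolding query_value_def using measurable_query_component by measurable

lemma measurable_query_mean:
  "(\<lambda>q. query_mean q P) \<in> borel_measurable (query_space :: ('n::finite, 'x::countable) query measure)"
proof -
  have "(\<lambda>(q, S). query_value q S) \<in>
    borel_measurable ((query_space :: ('n, 'x) query measure) \<Otimes>\<^sub>M count_space UNIV)"
    by (subst measurable_pair_swap_iff, rule measurable_pair_measure_countable1)
      (auto intro: measurable_query_value)
  then have "(\<lambda>(q, S). query_value q S) \<in>
    borel_measurable ((query_space :: ('n, 'x) query measure) \<Otimes>\<^sub>M measure_pmf (iid_sample P))"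
    by (simp cong: measurable_cong_sets sets_pair_measure_cong)
  from measure_pmf.borel_measurable_lebesgue_integral[OF this]
  show ?thesis by (simp add: query_mean_def)
qed

lemma measurable_max_error:
  fixes v :: "'c::countable \<Rightarrow> ('n, 'x) query \<Rightarrow> real"
  assumes v: "\<And>S. v S \<in> borel_measurable query_space"
  shows "(\<lambda>(S, \<pi>). max_error k (v S) \<pi>)
    \<in> borel_measurable (count_space UNIV \<Otimes>\<^sub>M transcript_space k)"
proof (rule measurable_pair_measure_countable1)
  fix S
  have "(\<lambda>\<pi>. \<bar>snd (\<pi> t) - v S (fst (\<pi> t))\<bar>) \<in> borel_measurable (transcript_space k)"
    if "t < k" for t
  proof -
    note [measurable] = v
    have [measurable]: "(\<lambda>\<pi>. \<pi> t) \<in> transcript_space k \<rightarrow>\<^sub>M (query_space \<Otimes>\<^sub>M borel)"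
      unfolding transcript_space_def using that by (intro measurable_component_singleton) simp
    show ?thesis by measurable
  qed
  then have "(\<lambda>\<pi>. Max ((\<lambda>t. \<bar>snd (\<pi> t) - v S (fst (\<pi> t))\<bar>) ` {..<k}))
      \<in> borel_measurable (transcript_space k)"
    by (intro borel_measurable_Max) auto
  then show "(\<lambda>\<pi>. case (S, \<pi>) of (S, \<pi>) \<Rightarrow> max_error k (v S) \<pi>) \<in> borel_measurable (transcript_space k)"
    by (simp add: max_error_def)
qed auto

end

theory Submission
  imports Defs
begin

text \<open>
  Fix a transcript \<open>\<pi>\<close> and let \<open>p S\<close> be the density at \<open>\<pi>\<close> of the transcript law for dataset \<open>S\<close>,
  with respect to the marginal law of transcripts. The posterior of the dataset given \<open>\<pi>\<close> has
  density \<open>p\<close> with respect to the prior, and privacy says that for \<open>i \<notin> fL \<pi>\<close> changing \<open>S i\<close>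
  changes \<open>p S\<close> by a factor of at most \<open>exp \<epsilon>\<close>. So under the posterior, even after conditioning on
  the other coordinates, the mean of a \<open>[0,1]\<close>-valued function of \<open>S i\<close> exceeds its prior mean by
  at most \<open>exp \<epsilon> - 1\<close>; for the at most \<open>\<kappa>\<close> coordinates in \<open>fL \<pi>\<close> by at most \<open>1\<close>. Integrating out
  one coordinate at a time and using Hoeffding's lemma, every query determined by \<open>\<pi>\<close> concentrates
  under the posterior. The theorem applies this to the query with the largest population error,
  whose sample error is controlled by sample accuracy.
\<close>

section \<open>Exponential moments and tails under reweighted product distributions\<close>

text \<open>Normalised by its total, \<open>w\<close> turns \<open>P\<close> into a probability
  measure \<open>Q\<close>, and Hoeffding's lemma applies around the \<open>Q\<close>-mean of
  \<open>f\<close>; \<open>c\<close> bounds how far that mean exceeds the \<open>P\<close>-mean. For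
  \<open>1 \<le> c\<close> this is automatic, as both means lie in the unit interval. An
  unnormalised \<open>w\<close> allows every section of a joint weight to be plugged in.\<close>

lemma weighted_hoeffding:
  fixes P :: "'x pmf" and w :: "'x \<Rightarrow> ennreal" and f :: "'x \<Rightarrow> real"
  assumes f: "\<And>x. f x \<in> {0..1}" and s: "s > 0"
    and c: "1 \<le> c \<or> 0 \<le> c \<and> (\<forall>x\<in>set_pmf P. \<forall>y\<in>set_pmf P. w x \<le> ennreal (1 + c) * w y)"
  shows "(\<integral>\<^sup>+x. w x * ennreal (exp (s * (f x - measure_pmf.expectation P f))) \<partial>P)
    \<le> ennreal (exp (s\<^sup>2 / 8 + s * c)) * (\<integral>\<^sup>+x. w x \<partial>P)"
proof -
  define W where "W = (\<integral>\<^sup>+x. w x \<partial>P)"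
  define e where "e = measure_pmf.expectation P f"
  have int_f: "integrable P f"
    using f by (intro measure_pmf.integrable_const_bound[where B = 1]) auto
  have e: "0 \<le> e" "e \<le> 1"
    using f measure_pmf.integral_le_const[OF int_f, of 1] by (auto simp: e_def)
  \<comment> \<open>Normalising needs a positive finite total. With total 0 the weight vanishes
    almost everywhere; with infinite total the right-hand side is infinite.\<close>
  consider "W = 0" | "W = \<infinity>" | "W \<noteq> 0" "W \<noteq> \<infinity>" by blast
  then have "(\<integral>\<^sup>+x. w x * ennreal (exp (s * (f x - e))) \<partial>P) \<le> ennreal (exp (s\<^sup>2 / 8 + s * c)) * W"
  proof cases
    case 1
    then have "AE x in P. w x = 0" by (simp add: W_def nn_integral_0_iff_AE)
    then have "(\<integral>\<^sup>+x. w x * ennreal (exp (s * (f x - e))) \<partial>P) = 0"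
      by (subst nn_integral_0_iff_AE) auto
    then show ?thesis by simp
  next
    case 2
    then show ?thesis by (simp add: ennreal_mult_top)
  next
    case 3
    define Q where "Q = density P (\<lambda>x. w x / W)"
    have "emeasure Q (space Q) = 1"
      using 3 ennreal_mult_divide_eq[of W 1]
      by (simp add: Q_def emeasure_density nn_integral_divide less_top flip: W_def)
    then interpret Q: prob_space Q by (rule prob_spaceI)
    interpret Q: interval_bounded_random_variable Q f 0 1
      using f by unfold_locales (auto simp: Q_def)
    define e' where "e' = Q.expectation f"
    have "e' \<le> e + c"
      using c
    proof (elim disjE conjE)
      assume "1 \<le> c"
      moreover have "e' \<le> 1"
        unfolding e'_def using f by (intro Q.integral_le_const[OF Q.integrable]) auto
      ultimately show ?thesis using e by linarith
    next
      assume c: "0 \<le> c" and ratio: "\<forall>x\<in>set_pmf P. \<forall>y\<in>set_pmf P. w x \<le> ennreal (1 + c) * w y"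
      \<comment> \<open>Averaging the ratio bound over \<open>y\<close> compares \<open>w x\<close>
        with \<open>W\<close>, so \<open>Q\<close> has density at most \<open>1 + c\<close> with
        respect to \<open>P\<close>.\<close>
      have w_le: "w x / W \<le> ennreal (1 + c)" if x: "x \<in> set_pmf P" for x
      proof -
        have "w x = (\<integral>\<^sup>+y. w x \<partial>P)" by (simp add: measure_pmf.emeasure_space_1)
        also have "\<dots> \<le> (\<integral>\<^sup>+y. ennreal (1 + c) * w y \<partial>P)"
          using ratio x by (intro nn_integral_mono_AE) (auto simp: AE_measure_pmf_iff)
        finally have "w x \<le> ennreal (1 + c) * W" by (simp add: W_def nn_integral_cmult)
        then have "w x / W \<le> ennreal (1 + c) * W / W" by (rule divide_right_mono_ennreal)
        also have "\<dots> = ennreal (1 + c)" using 3 by (simp add: ennreal_mult_divide_eq)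
        finally show ?thesis .
      qed
      have "ennreal e' = (\<integral>\<^sup>+x. ennreal (f x) \<partial>Q)"
        unfolding e'_def using f by (intro nn_integral_eq_integral[symmetric] Q.integrable) auto
      also have "\<dots> = (\<integral>\<^sup>+x. w x / W * ennreal (f x) \<partial>P)"
        by (simp add: Q_def nn_integral_density)
      also have "\<dots> \<le> (\<integral>\<^sup>+x. ennreal (1 + c) * ennreal (f x) \<partial>P)"
        using w_le by (intro nn_integral_mono_AE) (auto simp: AE_measure_pmf_iff intro!: mult_right_mono)
      also have "\<dots> = ennreal (1 + c) * ennreal e"
        unfolding e_def using f int_f by (simp add: nn_integral_cmult nn_integral_eq_integral)
      also have "\<dots> = ennreal ((1 + c) * e)" using c e by (simp add: ennreal_mult)
      finally have "e' \<le> (1 + c) * e" using c e by (subst (asm) ennreal_le_iff) auto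
      also have "\<dots> \<le> e + c" using c e using mult_left_le[of e c] by (simp add: algebra_simps)
      finally show ?thesis .
    qed
    \<comment> \<open>Recentring from \<open>e\<close> to \<open>e'\<close> costs the constant
      factor \<open>exp (s * (e' - e))\<close>, at most \<open>exp (s * c)\<close>; what remains is
      the centred moment under \<open>Q\<close>.\<close>
    have "(\<integral>\<^sup>+x. w x * ennreal (exp (s * (f x - e))) \<partial>P)
      = (\<integral>\<^sup>+x. W * ennreal (exp (s * (e' - e))) * (w x / W * ennreal (exp (s * (f x - e')))) \<partial>P)"
    proof (intro nn_integral_cong)
      fix x
      have "exp (s * (f x - e)) = exp (s * (e' - e)) * exp (s * (f x - e'))"
        by (simp add: algebra_simps flip: exp_add)
      moreover have "W * (w x / W) = w x"
        using 3 by (metis ennreal_mult_divide_eq ennreal_times_divide infinity_ennreal_def mult.commute)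
      ultimately show "w x * ennreal (exp (s * (f x - e)))
          = W * ennreal (exp (s * (e' - e))) * (w x / W * ennreal (exp (s * (f x - e'))))"
        by (metis ennreal_mult' exp_ge_zero mult.assoc mult.left_commute)
    qed
    also have "\<dots> = W * ennreal (exp (s * (e' - e))) * (\<integral>\<^sup>+x. ennreal (exp (s * (f x - e'))) \<partial>Q)"
      by (simp add: Q_def nn_integral_density nn_integral_cmult)
    also have "\<dots> \<le> W * ennreal (exp (s * (e' - e))) * ennreal (exp (s\<^sup>2 / 8))"
      using Q.Hoeffdings_lemma_nn_integral[OF s] by (intro mult_left_mono) (auto simp: e'_def)
    also have "\<dots> \<le> W * ennreal (exp (s * c)) * ennreal (exp (s\<^sup>2 / 8))"
      using \<open>e' \<le> e + c\<close> s by (intro mult_left_mono mult_right_mono ennreal_leI) auto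
    also have "\<dots> = ennreal (exp (s\<^sup>2 / 8 + s * c)) * W"
      by (simp add: exp_add ennreal_mult mult_ac)
    finally show ?thesis .
  qed
  then show ?thesis by (simp add: W_def e_def)
qed

text \<open>Induction on \<open>A\<close>: the one-dimensional bound handles the section of
  \<open>w\<close> along the removed coordinate, and the other coordinates see the marginal weight,
  which inherits their ratio bounds because these survive integration. The ratio is demanded only on
  the support, since the densities of transcript laws will be controlled only there.\<close>

lemma weighted_hoeffding_Pi_pmf:
  fixes P :: "'i \<Rightarrow> 'x pmf" and w :: "('i \<Rightarrow> 'x) \<Rightarrow> ennreal" and f :: "'i \<Rightarrow> 'x \<Rightarrow> real"
    and c :: "'i \<Rightarrow> real"
  assumes "finite A" and f: "\<And>i x. f i x \<in> {0..1}" and s: "s > 0"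
    and "\<And>i. i \<in> A \<Longrightarrow> 1 \<le> c i \<or> 0 \<le> c i \<and>
      (\<forall>S\<in>set_pmf (Pi_pmf A d P). \<forall>S'\<in>set_pmf (Pi_pmf A d P).
         (\<forall>j. j \<noteq> i \<longrightarrow> S j = S' j) \<longrightarrow> w S \<le> ennreal (1 + c i) * w S')"
  shows "(\<integral>\<^sup>+S. w S * ennreal (exp (s * (\<Sum>i\<in>A. f i (S i) - measure_pmf.expectation (P i) (f i)))) \<partial>Pi_pmf A d P)
    \<le> ennreal (exp (real (card A) * s\<^sup>2 / 8 + s * (\<Sum>i\<in>A. c i))) * (\<integral>\<^sup>+S. w S \<partial>Pi_pmf A d P)"
  using assms(1,4)
proof (induction A arbitrary: w rule: finite_induct)
  case empty
  then show ?case by simp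
next
  case (insert a A)
  let ?D = "Pi_pmf A d P"
  let ?g = "\<lambda>i x. f i x - measure_pmf.expectation (P i) (f i)"
  let ?C = "real (card A) * s\<^sup>2 / 8 + s * (\<Sum>i\<in>A. c i)"
  define w' where "w' S = (\<integral>\<^sup>+x. w (S(a := x)) \<partial>P a)" for S
  have supp: "S(a := x) \<in> set_pmf (Pi_pmf (insert a A) d P)" if "S \<in> set_pmf ?D" "x \<in> set_pmf (P a)" for S x
    using that insert.hyps by (auto simp: Pi_pmf_insert image_iff)
  have sum_upd: "(\<Sum>i\<in>insert a A. ?g i ((S(a := x)) i)) = ?g a x + (\<Sum>i\<in>A. ?g i (S i))" for S x
  proof -
    have "(\<Sum>i\<in>A. ?g i ((S(a := x)) i)) = (\<Sum>i\<in>A. ?g i (S i))"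
      using insert.hyps by (intro sum.cong) auto
    then show ?thesis using insert.hyps by simp
  qed
  have IH: "(\<integral>\<^sup>+S. w' S * ennreal (exp (s * (\<Sum>i\<in>A. ?g i (S i)))) \<partial>?D)
    \<le> ennreal (exp ?C) * (\<integral>\<^sup>+S. w' S \<partial>?D)"
  proof (rule insert.IH)
    fix i assume i: "i \<in> A"
    have "w' S \<le> ennreal (1 + c i) * w' S'"
      if "\<not> 1 \<le> c i" "S \<in> set_pmf ?D" "S' \<in> set_pmf ?D" "\<forall>j. j \<noteq> i \<longrightarrow> S j = S' j" for S S'
    proof -
      have "w' S \<le> (\<integral>\<^sup>+x. ennreal (1 + c i) * w (S'(a := x)) \<partial>P a)"
        unfolding w'_def
      proof (intro nn_integral_mono_AE, unfold AE_measure_pmf_iff, rule ballI)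
        fix x assume "x \<in> set_pmf (P a)"
        then show "w (S(a := x)) \<le> ennreal (1 + c i) * w (S'(a := x))"
          using insert.prems[of i] i that supp by auto
      qed
      then show ?thesis by (simp add: w'_def nn_integral_cmult)
    qed
    then show "1 \<le> c i \<or> 0 \<le> c i \<and> (\<forall>S\<in>set_pmf ?D. \<forall>S'\<in>set_pmf ?D.
        (\<forall>j. j \<noteq> i \<longrightarrow> S j = S' j) \<longrightarrow> w' S \<le> ennreal (1 + c i) * w' S')"
      using insert.prems[of i] i by blast
  qed
  \<comment> \<open>Two updates of \<open>S\<close> at \<open>a\<close> differ only at
    \<open>a\<close>, so the hypothesis for index \<open>a\<close> is the ratio condition along this
    section.\<close>
  have coordinate: "(\<integral>\<^sup>+x. w (S(a := x)) * ennreal (exp (s * ?g a x)) \<partial>P a)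
      \<le> ennreal (exp (s\<^sup>2 / 8 + s * c a)) * w' S" if "S \<in> set_pmf ?D" for S
    unfolding w'_def
    by (rule weighted_hoeffding[OF f s]) (use insert.prems[of a] that supp in auto)
  \<comment> \<open>Fubini with coordinate \<open>a\<close> innermost, so that the factors of the
    other coordinates are constants there.\<close>
  have Pi_insert: "(\<integral>\<^sup>+S. h S \<partial>Pi_pmf (insert a A) d P) = (\<integral>\<^sup>+S. \<integral>\<^sup>+x. h (S(a := x)) \<partial>P a \<partial>?D)"
    for h :: "('i \<Rightarrow> 'x) \<Rightarrow> ennreal"
    using insert.hyps
    by (simp add: Pi_pmf_insert case_prod_unfold pair_commute_pmf[of "P a"] nn_integral_pair_pmf')
  have "(\<integral>\<^sup>+S. w S * ennreal (exp (s * (\<Sum>i\<in>insert a A. ?g i (S i)))) \<partial>Pi_pmf (insert a A) d P)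
    = (\<integral>\<^sup>+S. ennreal (exp (s * (\<Sum>i\<in>A. ?g i (S i)))) *
        (\<integral>\<^sup>+x. w (S(a := x)) * ennreal (exp (s * ?g a x)) \<partial>P a) \<partial>?D)"
    unfolding Pi_insert sum_upd
    by (simp add: distrib_left exp_add ennreal_mult mult_ac flip: nn_integral_cmult)
  also have "\<dots> \<le> (\<integral>\<^sup>+S. ennreal (exp (s\<^sup>2 / 8 + s * c a)) *
      (w' S * ennreal (exp (s * (\<Sum>i\<in>A. ?g i (S i))))) \<partial>?D)"
  proof (intro nn_integral_mono_AE, unfold AE_measure_pmf_iff, rule ballI)
    fix S assume "S \<in> set_pmf ?D"
    from mult_left_mono[OF coordinate[OF this], of "ennreal (exp (s * (\<Sum>i\<in>A. ?g i (S i))))"]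
    show "ennreal (exp (s * (\<Sum>i\<in>A. ?g i (S i)))) *
        (\<integral>\<^sup>+x. w (S(a := x)) * ennreal (exp (s * ?g a x)) \<partial>P a)
      \<le> ennreal (exp (s\<^sup>2 / 8 + s * c a)) * (w' S * ennreal (exp (s * (\<Sum>i\<in>A. ?g i (S i)))))"
      by (simp add: mult_ac)
  qed
  also have "\<dots> = ennreal (exp (s\<^sup>2 / 8 + s * c a)) *
      (\<integral>\<^sup>+S. w' S * ennreal (exp (s * (\<Sum>i\<in>A. ?g i (S i)))) \<partial>?D)"
    by (simp add: nn_integral_cmult)
  also have "\<dots> \<le> ennreal (exp (s\<^sup>2 / 8 + s * c a)) * (ennreal (exp ?C) * (\<integral>\<^sup>+S. w' S \<partial>?D))"
    by (intro mult_left_mono IH) auto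
  also have "\<dots> = ennreal (exp (s\<^sup>2 / 8 + s * c a) * exp ?C) * (\<integral>\<^sup>+S. w S \<partial>Pi_pmf (insert a A) d P)"
    by (simp add: Pi_insert w'_def ennreal_mult mult_ac)
  also have "exp (s\<^sup>2 / 8 + s * c a) * exp ?C
      = exp (real (card (insert a A)) * s\<^sup>2 / 8 + s * (\<Sum>i\<in>insert a A. c i))"
    using insert.hyps by (simp add: field_simps flip: exp_add)
  finally show ?case .
qed

text \<open>Chernoff's method with \<open>s = 4 * \<tau>\<close>, which minimises
  \<open>n * s\<^sup>2 / 8 - n * s * \<tau>\<close> for \<open>n = card A\<close>; the shift by the
  sum of \<open>c\<close> cancels against the same term in the moment bound.\<close>

lemma weighted_tail_Pi_pmf:
  fixes P :: "'i \<Rightarrow> 'x pmf" and w :: "('i \<Rightarrow> 'x) \<Rightarrow> ennreal" and f :: "'i \<Rightarrow> 'x \<Rightarrow> real"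
    and c :: "'i \<Rightarrow> real"
  assumes A: "finite A" and f: "\<And>i x. f i x \<in> {0..1}" and \<tau>: "\<tau> > 0"
    and c: "\<And>i. i \<in> A \<Longrightarrow> 1 \<le> c i \<or> 0 \<le> c i \<and>
      (\<forall>S\<in>set_pmf (Pi_pmf A d P). \<forall>S'\<in>set_pmf (Pi_pmf A d P).
         (\<forall>j. j \<noteq> i \<longrightarrow> S j = S' j) \<longrightarrow> w S \<le> ennreal (1 + c i) * w S')"
  shows "(\<integral>\<^sup>+S. w S * indicator {S. real (card A) * \<tau> + (\<Sum>i\<in>A. c i)
        < \<bar>\<Sum>i\<in>A. f i (S i) - measure_pmf.expectation (P i) (f i)\<bar>} S \<partial>Pi_pmf A d P)
    \<le> ennreal (2 * exp (- 2 * real (card A) * \<tau>\<^sup>2)) * (\<integral>\<^sup>+S. w S \<partial>Pi_pmf A d P)"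
proof -
  define X where "X f S = (\<Sum>i\<in>A. f i (S i) - measure_pmf.expectation (P i) (f i))"
    for f :: "'i \<Rightarrow> 'x \<Rightarrow> real" and S
  let ?D = "Pi_pmf A d P" and ?n = "real (card A)"
  let ?b = "?n * \<tau> + (\<Sum>i\<in>A. c i)"
  have upper: "(\<integral>\<^sup>+S. w S * indicator {S. ?b < X f S} S \<partial>?D)
      \<le> ennreal (exp (- 2 * ?n * \<tau>\<^sup>2)) * (\<integral>\<^sup>+S. w S \<partial>?D)"
    if f: "\<And>i x. f i x \<in> {0..1}" for f
  proof -
    have "(\<integral>\<^sup>+S. w S * indicator {S. ?b < X f S} S \<partial>?D)
      \<le> (\<integral>\<^sup>+S. ennreal (exp (- (4 * \<tau>) * ?b)) * (w S * ennreal (exp (4 * \<tau> * X f S))) \<partial>?D)"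
    proof (intro nn_integral_mono)
      fix S
      have "indicator {S. ?b < X f S} S \<le> ennreal (exp (4 * \<tau> * (X f S - ?b)))"
        using \<tau> by (auto split: split_indicator simp: zero_le_mult_iff)
      also have "exp (4 * \<tau> * (X f S - ?b)) = exp (- (4 * \<tau>) * ?b) * exp (4 * \<tau> * X f S)"
        by (simp add: algebra_simps flip: exp_add)
      finally show "w S * indicator {S. ?b < X f S} S
          \<le> ennreal (exp (- (4 * \<tau>) * ?b)) * (w S * ennreal (exp (4 * \<tau> * X f S)))"
        by (metis ennreal_mult' exp_ge_zero mult.left_commute mult_left_mono zero_le)
    qed
    also have "\<dots> = ennreal (exp (- (4 * \<tau>) * ?b)) * (\<integral>\<^sup>+S. w S * ennreal (exp (4 * \<tau> * X f S)) \<partial>?D)"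
      by (rule nn_integral_cmult) simp
    also have "\<dots> \<le> ennreal (exp (- (4 * \<tau>) * ?b)) *
        (ennreal (exp (?n * (4 * \<tau>)\<^sup>2 / 8 + 4 * \<tau> * (\<Sum>i\<in>A. c i))) * (\<integral>\<^sup>+S. w S \<partial>?D))"
      unfolding X_def using \<tau> by (intro mult_left_mono weighted_hoeffding_Pi_pmf A f c) auto
    also have "\<dots> = ennreal (exp (- (4 * \<tau>) * ?b) * exp (?n * (4 * \<tau>)\<^sup>2 / 8 + 4 * \<tau> * (\<Sum>i\<in>A. c i)))
        * (\<integral>\<^sup>+S. w S \<partial>?D)"
      by (simp add: ennreal_mult mult.assoc)
    also have "exp (- (4 * \<tau>) * ?b) * exp (?n * (4 * \<tau>)\<^sup>2 / 8 + 4 * \<tau> * (\<Sum>i\<in>A. c i)) = exp (- 2 * ?n * \<tau>\<^sup>2)"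
      by (simp add: algebra_simps power2_eq_square flip: exp_add)
    finally show ?thesis .
  qed
  \<comment> \<open>The lower tail of \<open>f\<close> is the upper tail of \<open>1 - f\<close>.
    The conditions on \<open>c\<close> concern \<open>w\<close> alone, so they carry over.\<close>
  define f' where "f' i x = 1 - f i x" for i x
  have "integrable (P i) (f i)" for i
    using f by (intro measure_pmf.integrable_const_bound[where B = 1]) auto
  then have "measure_pmf.expectation (P i) (f' i) = 1 - measure_pmf.expectation (P i) (f i)" for i
    by (simp add: f'_def[abs_def])
  then have neg: "X f' S = - X f S" for S
    unfolding X_def sum_negf[symmetric] by (intro sum.cong) (auto simp: f'_def)
  have "(\<integral>\<^sup>+S. w S * indicator {S. ?b < \<bar>X f S\<bar>} S \<partial>?D)
    \<le> (\<integral>\<^sup>+S. w S * indicator {S. ?b < X f S} S + w S * indicator {S. ?b < X f' S} S \<partial>?D)"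
    by (intro nn_integral_mono) (auto simp: neg split: split_indicator)
  also have "\<dots> = (\<integral>\<^sup>+S. w S * indicator {S. ?b < X f S} S \<partial>?D) + (\<integral>\<^sup>+S. w S * indicator {S. ?b < X f' S} S \<partial>?D)"
    by (rule nn_integral_add) simp_all
  also have "\<dots> \<le> ennreal (exp (- 2 * ?n * \<tau>\<^sup>2)) * (\<integral>\<^sup>+S. w S \<partial>?D)
      + ennreal (exp (- 2 * ?n * \<tau>\<^sup>2)) * (\<integral>\<^sup>+S. w S \<partial>?D)"
    using f by (intro add_mono upper) (auto simp: f'_def)
  also have "\<dots> = ennreal (2 * exp (- 2 * ?n * \<tau>\<^sup>2)) * (\<integral>\<^sup>+S. w S \<partial>?D)"
    by (subst mult_2, subst ennreal_plus) (simp_all add: distrib_right)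
  finally show ?thesis by (simp add: X_def)
qed

section \<open>Linear queries under a weight with bounded ratios\<close>

lemma query_in_unit_interval: "q \<in> space query_space \<Longrightarrow> q i x \<in> {0..1}"
  by (simp add: query_space_def space_PiM space_restrict_space PiE_UNIV_domain Pi_iff)

lemma query_mean_eq:
  fixes P :: "'x pmf" and q :: "('n::finite, 'x) query"
  assumes q: "q \<in> space query_space"
  shows "query_mean q P = (1 / real CARD('n)) * (\<Sum>i\<in>UNIV. measure_pmf.expectation P (q i))"
proof -
  have comp: "measure_pmf.expectation (iid_sample P) (\<lambda>S. q i (S i)) = measure_pmf.expectation P (q i)" for i
  proof -
    have "map_pmf (\<lambda>S. S i) (iid_sample P) = P"
      by (simp add: iid_sample_def Pi_pmf_component)
    then show ?thesis by (metis integral_map_pmf)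
  qed
  have "integrable (iid_sample P) (\<lambda>S. q i (S i))" for i
    using query_in_unit_interval[OF q] by (intro measure_pmf.integrable_const_bound[where B = 1]) auto
  then show ?thesis by (simp add: query_mean_def query_value_def comp)
qed

lemma private_weight_tail:
  fixes P :: "'x pmf" and w :: "('n::finite, 'x) dataset \<Rightarrow> ennreal" and L :: "'n set"
  assumes q: "q \<in> space query_space" and \<tau>: "\<tau> > 0" and \<epsilon>: "\<epsilon> \<ge> 0" and L: "real (card L) \<le> \<kappa>"
    and ratio: "\<And>i S S'. \<lbrakk>i \<notin> L; S \<in> set_pmf (iid_sample P); S' \<in> set_pmf (iid_sample P);
        \<forall>j. j \<noteq> i \<longrightarrow> S j = S' j\<rbrakk> \<Longrightarrow> w S \<le> ennreal (exp \<epsilon>) * w S'"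
  shows "(\<integral>\<^sup>+S. w S * indicator {S. \<tau> + (exp \<epsilon> - 1) + \<kappa> / real CARD('n)
        < \<bar>query_value q S - query_mean q P\<bar>} S \<partial>iid_sample P)
    \<le> ennreal (2 * exp (- 2 * real CARD('n) * \<tau>\<^sup>2)) * (\<integral>\<^sup>+S. w S \<partial>iid_sample P)"
proof -
  \<comment> \<open>Indices in \<open>L\<close> get the value 1, for which no ratio bound is
    required; elsewhere \<open>1 + c i\<close> is the privacy factor
    \<open>exp \<epsilon>\<close>.\<close>
  define c where "c i = (if i \<in> L then 1 else exp \<epsilon> - 1)" for i
  let ?m = "real CARD('n)"
  let ?X = "\<lambda>S. \<Sum>i\<in>UNIV. q i (S i) - measure_pmf.expectation P (q i)"
  have "(\<Sum>i\<in>UNIV. c i) \<le> (\<Sum>i\<in>UNIV. (exp \<epsilon> - 1) + indicator L i)"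
    using \<epsilon> by (intro sum_mono) (auto simp: c_def)
  then have "(\<Sum>i\<in>UNIV. c i) \<le> ?m * (exp \<epsilon> - 1) + \<kappa>"
    using L by (simp add: sum.distrib indicator_def of_bool_def sum.If_cases)
  then have "?m * \<tau> + (\<Sum>i\<in>UNIV. c i) \<le> ?m * (\<tau> + (exp \<epsilon> - 1) + \<kappa> / ?m)"
    by (simp add: algebra_simps)
  moreover have "\<bar>?X S\<bar> = ?m * \<bar>query_value q S - query_mean q P\<bar>" for S
    by (simp add: query_mean_eq[OF q] query_value_def sum_subtractf abs_mult flip: right_diff_distrib diff_divide_distrib)
  ultimately have "?m * \<tau> + (\<Sum>i\<in>UNIV. c i) < \<bar>?X S\<bar>"
    if "\<tau> + (exp \<epsilon> - 1) + \<kappa> / ?m < \<bar>query_value q S - query_mean q P\<bar>" for S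
    using mult_strict_left_mono[OF that, of ?m] by (metis le_less_trans of_nat_0_less_iff zero_less_card_finite)
  then have "(\<integral>\<^sup>+S. w S * indicator {S. \<tau> + (exp \<epsilon> - 1) + \<kappa> / ?m
        < \<bar>query_value q S - query_mean q P\<bar>} S \<partial>iid_sample P)
    \<le> (\<integral>\<^sup>+S. w S * indicator {S. ?m * \<tau> + (\<Sum>i\<in>UNIV. c i) < \<bar>?X S\<bar>} S \<partial>iid_sample P)"
    by (intro nn_integral_mono mult_left_mono) (auto split: split_indicator)
  also have "\<dots> \<le> ennreal (2 * exp (- 2 * ?m * \<tau>\<^sup>2)) * (\<integral>\<^sup>+S. w S \<partial>iid_sample P)"
    unfolding iid_sample_def
    by (rule weighted_tail_Pi_pmf[OF finite query_in_unit_interval[OF q] \<tau>])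
      (use ratio \<epsilon> in \<open>auto simp: c_def iid_sample_def add_diff_eq simp del: ennreal_plus\<close>)
  finally show ?thesis .
qed

section \<open>Transcript densities and the posterior argument\<close>

text \<open>Turns the event-wise privacy inequality into a pointwise one: on the set
  \<open>E\<close> of violations inside \<open>A\<close>, integrating the strict inequality would
  contradict the assumed bound for \<open>E\<close>.\<close>

lemma AE_density_le:
  assumes [measurable]: "p \<in> borel_measurable N" "p' \<in> borel_measurable N" "A \<in> sets N"
    and fin: "emeasure (density N p) (space N) \<noteq> \<infinity>"
    and le: "\<And>E. \<lbrakk>E \<in> sets N; E \<subseteq> A\<rbrakk> \<Longrightarrow> emeasure (density N p) E \<le> r * emeasure (density N p') E"
  shows "AE x in N. x \<in> A \<longrightarrow> p x \<le> r * p' x"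
proof (rule ccontr)
  define E where "E = {x \<in> space N. x \<in> A \<and> r * p' x < p x}"
  have [measurable]: "E \<in> sets N" by (simp add: E_def)
  have "E \<subseteq> A" by (auto simp: E_def)
  have *: "x \<in> A \<longrightarrow> p x \<le> r * p' x"
    if "x \<in> space N" "p x * indicator E x \<le> r * p' x * indicator E x" for x
    using that by (cases "r * p' x < p x") (auto simp: E_def)
  have "AE x in N. x \<in> A \<longrightarrow> p x \<le> r * p' x"
    if "AE x in N. p x * indicator E x \<le> r * p' x * indicator E x"
    using that by (rule AE_mp) (intro AE_I2 impI *)
  moreover assume "\<not> (AE x in N. x \<in> A \<longrightarrow> p x \<le> r * p' x)"
  ultimately have "\<not> (AE x in N. p x * indicator E x \<le> r * p' x * indicator E x)"
    by blast
  \<comment> \<open>Strictness survives integration only if the smaller integral is finite; on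
    \<open>E\<close> it is dominated by the finite mass of \<open>p\<close>.\<close>
  moreover have "(\<integral>\<^sup>+x. r * p' x * indicator E x \<partial>N) \<le> (\<integral>\<^sup>+x. p x \<partial>N)"
    by (intro nn_integral_mono) (auto simp: E_def split: split_indicator)
  then have "(\<integral>\<^sup>+x. r * p' x * indicator E x \<partial>N) \<noteq> \<infinity>"
    using fin by (auto simp: emeasure_density top_unique)
  moreover have "AE x in N. r * p' x * indicator E x \<le> p x * indicator E x"
    by (intro AE_I2) (auto simp: E_def split: split_indicator)
  ultimately have "(\<integral>\<^sup>+x. r * p' x * indicator E x \<partial>N) < (\<integral>\<^sup>+x. p x * indicator E x \<partial>N)"
    by (intro nn_integral_less) auto
  moreover have "(\<integral>\<^sup>+x. p x * indicator E x \<partial>N) \<le> r * (\<integral>\<^sup>+x. p' x * indicator E x \<partial>N)"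
    using le[OF _ \<open>E \<subseteq> A\<close>] by (simp add: emeasure_density)
  ultimately show False by (simp add: mult.assoc nn_integral_cmult)
qed

text \<open>Exchanging the integrals over datasets and transcripts puts the transcript outside. Once
  \<pi> is fixed, \<open>g \<pi>\<close> is a fixed query, however adaptively it was chosen, and the
  weighted tail bound applies with weight \<open>S \<mapsto> p S \<pi>\<close>.\<close>

lemma private_kernel_tail:
  fixes P :: "'x::countable pmf" and \<mu> :: "('n::finite, 'x) dataset \<Rightarrow> 'p measure"
    and fL :: "'p \<Rightarrow> 'n set"
  assumes \<mu>: "\<And>S. \<mu> S \<in> space (prob_algebra T)"
    and fL: "fL \<in> T \<rightarrow>\<^sub>M count_space UNIV"
    and \<kappa>: "\<And>\<pi>. \<pi> \<in> space T \<Longrightarrow> real (card (fL \<pi>)) \<le> \<kappa>"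
    and dp: "\<And>i S S' E. \<lbrakk>\<forall>j. j \<noteq> i \<longrightarrow> S j = S' j; E \<in> sets T; i \<notin> (\<Union>\<pi>\<in>E. fL \<pi>)\<rbrakk> \<Longrightarrow>
        measure (\<mu> S) E \<le> exp \<epsilon> * measure (\<mu> S') E"
    and g: "g \<in> T \<rightarrow>\<^sub>M query_space" and \<tau>: "\<tau> > 0" and \<epsilon>: "\<epsilon> \<ge> 0"
  shows "(\<integral>\<^sup>+S. emeasure (\<mu> S) {\<pi> \<in> space T. \<tau> + (exp \<epsilon> - 1) + \<kappa> / real CARD('n)
        < \<bar>query_value (g \<pi>) S - query_mean (g \<pi>) P\<bar>} \<partial>iid_sample P)
    \<le> ennreal (2 * exp (- 2 * real CARD('n) * \<tau>\<^sup>2))"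
proof -
  let ?D = "iid_sample P :: ('n, 'x) dataset pmf"
  define B where "B S = {\<pi> \<in> space T. \<tau> + (exp \<epsilon> - 1) + \<kappa> / real CARD('n)
        < \<bar>query_value (g \<pi>) S - query_mean (g \<pi>) P\<bar>}" for S
  have B: "B S \<in> sets T" for S
  proof -
    note [measurable] = measurable_compose[OF g measurable_query_value]
      measurable_compose[OF g measurable_query_mean]
    show ?thesis unfolding B_def by measurable
  qed
  have \<mu>_kernel: "\<mu> \<in> count_space UNIV \<rightarrow>\<^sub>M prob_algebra T"
    using \<mu> by (simp add: measurable_count_space_eq1)
  have sets_\<mu>[simp]: "sets (\<mu> S) = sets T" and prob_\<mu>: "prob_space (\<mu> S)" for S
    using \<mu>[of S] by (auto simp: space_prob_algebra)
  have D: "measure_pmf ?D \<in> space (prob_algebra (count_space UNIV))"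
    by (simp add: space_prob_algebra measure_pmf.prob_space_axioms)
  define N where "N = measure_pmf ?D \<bind> \<mu>"
  have N: "N \<in> space (prob_algebra T)"
    using measurable_bind_prob_space[OF measurable_const[OF D] \<mu>_kernel, of "count_space UNIV"]
    unfolding N_def by (auto dest!: measurable_space)
  then interpret N: prob_space N by (simp add: space_prob_algebra)
  have sets_N[simp, measurable_cong]: "sets N = sets T" using N by (simp add: space_prob_algebra)
  then have space_N: "space N = space T" by (rule sets_eq_imp_space_eq)
  define p where "p S = RN_deriv N (\<mu> S)" for S
  have [measurable]: "p S \<in> borel_measurable N" for S by (simp add: p_def)
  \<comment> \<open>A null set of the mixture \<open>N\<close> is null for every
    \<open>\<mu> S\<close> of positive prior probability, which is why \<open>S\<close> must lie in
    the support.\<close>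
  have density: "density N (p S) = \<mu> S" if "S \<in> set_pmf ?D" for S
    unfolding p_def
  proof (rule N.density_RN_deriv)
    show "absolutely_continuous N (\<mu> S)"
      unfolding absolutely_continuous_def
    proof
      fix E assume "E \<in> null_sets N"
      then have E: "E \<in> sets T" "emeasure N E = 0" by auto
      then have "AE S in ?D. emeasure (\<mu> S) E = 0"
        by (simp add: N_def emeasure_bind_prob_algebra[OF D \<mu>_kernel] nn_integral_0_iff_AE)
      then show "E \<in> null_sets (\<mu> S)" using E that by (auto simp: AE_measure_pmf_iff)
    qed
  qed simp
  have emeasure_\<mu>: "emeasure (\<mu> S) E = (\<integral>\<^sup>+\<pi>. p S \<pi> * indicator E \<pi> \<partial>N)"
    if "S \<in> set_pmf ?D" "E \<in> sets T" for S E
    using that by (simp add: emeasure_density flip: density)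
  have ratio: "AE \<pi> in N. i \<notin> fL \<pi> \<longrightarrow> p S \<pi> \<le> ennreal (exp \<epsilon>) * p S' \<pi>"
    if S: "S \<in> set_pmf ?D" "S' \<in> set_pmf ?D" and neighbours: "\<forall>j. j \<noteq> i \<longrightarrow> S j = S' j" for i S S'
  proof -
    \<comment> \<open>Every measurable subset of \<open>?A\<close> is an event avoiding index
      \<open>i\<close>, so privacy applies to all of them. Measurability of \<open>fL\<close> makes
      \<open>?A\<close> itself an event.\<close>
    let ?A = "{\<pi> \<in> space T. i \<notin> fL \<pi>}"
    have "?A = fL -` {L. i \<notin> L} \<inter> space T" by auto
    also have "\<dots> \<in> sets T" by (rule measurable_sets[OF fL]) simp
    finally have A: "?A \<in> sets T" .
    have "AE \<pi> in N. \<pi> \<in> ?A \<longrightarrow> p S \<pi> \<le> ennreal (exp \<epsilon>) * p S' \<pi>"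
    proof (rule AE_density_le)
      show "emeasure (density N (p S)) (space N) \<noteq> \<infinity>"
        using S by (simp add: density finite_measure.emeasure_finite prob_space.finite_measure prob_\<mu>)
      fix E assume E: "E \<in> sets N" "E \<subseteq> ?A"
      interpret S: prob_space "\<mu> S" by (rule prob_\<mu>)
      interpret S': prob_space "\<mu> S'" by (rule prob_\<mu>)
      have "measure (\<mu> S) E \<le> exp \<epsilon> * measure (\<mu> S') E"
        using E neighbours by (intro dp) auto
      then show "emeasure (density N (p S)) E \<le> ennreal (exp \<epsilon>) * emeasure (density N (p S')) E"
        using S by (simp add: density S.emeasure_eq_measure S'.emeasure_eq_measure flip: ennreal_mult)
    qed (use A in simp_all)
    then show ?thesis by (rule AE_mp) (auto simp: space_N intro!: AE_I2)
  qed
  \<comment> \<open>The exceptional null set depends on \<open>i\<close>, \<open>S\<close> and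
    \<open>S'\<close>; as there are countably many triples, one null set serves them all.\<close>
  have "AE \<pi> in N. \<forall>i S S'. S \<in> set_pmf ?D \<longrightarrow> S' \<in> set_pmf ?D \<longrightarrow> (\<forall>j. j \<noteq> i \<longrightarrow> S j = S' j) \<longrightarrow>
      i \<notin> fL \<pi> \<longrightarrow> p S \<pi> \<le> ennreal (exp \<epsilon>) * p S' \<pi>"
    unfolding AE_all_countable using ratio by auto
  then have tail: "AE \<pi> in N. (\<integral>\<^sup>+S. p S \<pi> * indicator (B S) \<pi> \<partial>?D)
      \<le> ennreal (2 * exp (- 2 * real CARD('n) * \<tau>\<^sup>2)) * (\<integral>\<^sup>+S. p S \<pi> \<partial>?D)"
  proof (rule AE_mp, intro AE_I2 impI)
    fix \<pi> assume \<pi>: "\<pi> \<in> space N" and *: "\<forall>i S S'. S \<in> set_pmf ?D \<longrightarrow> S' \<in> set_pmf ?D \<longrightarrow>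
      (\<forall>j. j \<noteq> i \<longrightarrow> S j = S' j) \<longrightarrow> i \<notin> fL \<pi> \<longrightarrow> p S \<pi> \<le> ennreal (exp \<epsilon>) * p S' \<pi>"
    have "g \<pi> \<in> space query_space" "real (card (fL \<pi>)) \<le> \<kappa>"
      using \<pi> \<kappa> measurable_space[OF g] by (auto simp: space_N)
    from private_weight_tail[OF this(1) \<tau> \<epsilon> this(2), of P "\<lambda>S. p S \<pi>"] * \<pi>
    show "(\<integral>\<^sup>+S. p S \<pi> * indicator (B S) \<pi> \<partial>?D)
        \<le> ennreal (2 * exp (- 2 * real CARD('n) * \<tau>\<^sup>2)) * (\<integral>\<^sup>+S. p S \<pi> \<partial>?D)"
      by (simp add: B_def indicator_def space_N)
  qed
  interpret DN: pair_sigma_finite "measure_pmf ?D" N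
    by (intro pair_sigma_finite.intro measure_pmf.sigma_finite_measure_axioms N.sigma_finite_measure_axioms)
  have fubini: "(\<integral>\<^sup>+S. \<integral>\<^sup>+\<pi>. h S \<pi> \<partial>N \<partial>?D) = (\<integral>\<^sup>+\<pi>. \<integral>\<^sup>+S. h S \<pi> \<partial>?D \<partial>N)"
    if "\<And>S. h S \<in> borel_measurable N" for h
  proof -
    have "(\<lambda>(S, \<pi>). h S \<pi>) \<in> borel_measurable (count_space UNIV \<Otimes>\<^sub>M N)"
      by (rule measurable_pair_measure_countable1) (use that in auto)
    then have "(\<lambda>(S, \<pi>). h S \<pi>) \<in> borel_measurable (measure_pmf ?D \<Otimes>\<^sub>M N)"
      by (simp cong: measurable_cong_sets sets_pair_measure_cong)
    from DN.Fubini'[OF this] show ?thesis by simp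
  qed
  have [measurable]: "B S \<in> sets N" for S using B by simp
  have "(\<integral>\<^sup>+S. emeasure (\<mu> S) (B S) \<partial>?D) = (\<integral>\<^sup>+S. \<integral>\<^sup>+\<pi>. p S \<pi> * indicator (B S) \<pi> \<partial>N \<partial>?D)"
    using emeasure_\<mu> B by (intro nn_integral_cong_AE) (auto simp: AE_measure_pmf_iff)
  also have "\<dots> = (\<integral>\<^sup>+\<pi>. \<integral>\<^sup>+S. p S \<pi> * indicator (B S) \<pi> \<partial>?D \<partial>N)"
    by (rule fubini) simp
  also have "\<dots> \<le> (\<integral>\<^sup>+\<pi>. \<integral>\<^sup>+S. ennreal (2 * exp (- 2 * real CARD('n) * \<tau>\<^sup>2)) * p S \<pi> \<partial>?D \<partial>N)"
    using tail by (intro nn_integral_mono_AE) (simp add: nn_integral_cmult)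
  also have "\<dots> = (\<integral>\<^sup>+S. \<integral>\<^sup>+\<pi>. ennreal (2 * exp (- 2 * real CARD('n) * \<tau>\<^sup>2)) * p S \<pi> \<partial>N \<partial>?D)"
    by (rule fubini[symmetric]) simp
  also have "\<dots> = ennreal (2 * exp (- 2 * real CARD('n) * \<tau>\<^sup>2)) * (\<integral>\<^sup>+S. \<integral>\<^sup>+\<pi>. p S \<pi> \<partial>N \<partial>?D)"
    by (simp add: nn_integral_cmult)
  \<comment> \<open>After swapping back, the total weight is the average mass of the laws
    \<open>\<mu> S\<close>, hence 1.\<close>
  also have "(\<integral>\<^sup>+S. \<integral>\<^sup>+\<pi>. p S \<pi> \<partial>N \<partial>?D) = (\<integral>\<^sup>+S. emeasure (\<mu> S) (space (\<mu> S)) \<partial>?D)"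
  proof (intro nn_integral_cong_AE, unfold AE_measure_pmf_iff, rule ballI)
    fix S assume S: "S \<in> set_pmf ?D"
    have "(\<integral>\<^sup>+\<pi>. p S \<pi> \<partial>N) = emeasure (density N (p S)) (space N)"
      by (subst emeasure_density) (auto simp: space_N intro!: nn_integral_cong)
    then show "(\<integral>\<^sup>+\<pi>. p S \<pi> \<partial>N) = emeasure (\<mu> S) (space (\<mu> S))"
      using S by (metis density space_density)
  qed
  also have "\<dots> = 1" using prob_\<mu> by (simp add: prob_space.emeasure_space_1 measure_pmf.emeasure_space_1)
  finally show ?thesis by (simp add: B_def)
qed

section \<open>Transfer to the joint law of dataset and transcript\<close>

lemma emeasure_sample_interaction:
  fixes M :: "('n::finite, 'x::countable, 's) mechanism"
  assumes M: "mechanism M" and A: "adversary A"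
    and B: "B \<in> sets (count_space UNIV \<Otimes>\<^sub>M transcript_space k)"
  shows "emeasure (sample_interaction k M A P) B
    = (\<integral>\<^sup>+S. emeasure (interaction k M A S) {\<pi> \<in> space (transcript_space k). (S, \<pi>) \<in> B} \<partial>iid_sample P)"
proof -
  let ?T = "transcript_space k :: ('n, 'x) transcript measure"
  have D: "measure_pmf (iid_sample P) \<in> space (prob_algebra (count_space UNIV))"
    by (simp add: space_prob_algebra measure_pmf.prob_space_axioms)
  have I[measurable]: "interaction k M A \<in> count_space UNIV \<rightarrow>\<^sub>M prob_algebra ?T"
    using interaction_prob_algebra[OF M A] by (simp add: measurable_count_space_eq1)
  have return: "(\<lambda>\<pi>. return (count_space UNIV \<Otimes>\<^sub>M ?T) (S, \<pi>)) \<in> ?T \<rightarrow>\<^sub>M prob_algebra (count_space UNIV \<Otimes>\<^sub>M ?T)"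
    for S :: "('n, 'x) dataset"
    by measurable
  have kernel: "(\<lambda>S. interaction k M A S \<bind> (\<lambda>\<pi>. return (count_space UNIV \<Otimes>\<^sub>M ?T) (S, \<pi>)))
    \<in> count_space UNIV \<rightarrow>\<^sub>M prob_algebra (count_space UNIV \<Otimes>\<^sub>M ?T)"
    by (intro measurable_bind_prob_space2[OF I]) measurable
  have "emeasure (interaction k M A S \<bind> (\<lambda>\<pi>. return (count_space UNIV \<Otimes>\<^sub>M ?T) (S, \<pi>))) B
    = emeasure (interaction k M A S) {\<pi> \<in> space ?T. (S, \<pi>) \<in> B}" for S
  proof -
    have I_S: "interaction k M A S \<in> space (prob_algebra ?T)"
      by (rule interaction_prob_algebra[OF M A])
    then have sets: "sets (interaction k M A S) = sets ?T" by (simp add: space_prob_algebra)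
    have B_S: "{\<pi> \<in> space ?T. (S, \<pi>) \<in> B} \<in> sets ?T"
    proof -
      have "{\<pi> \<in> space ?T. (S, \<pi>) \<in> B} = Pair S -` B \<inter> space ?T" by auto
      also have "\<dots> \<in> sets ?T" using B by measurable
      finally show ?thesis .
    qed
    have "emeasure (interaction k M A S \<bind> (\<lambda>\<pi>. return (count_space UNIV \<Otimes>\<^sub>M ?T) (S, \<pi>))) B
      = (\<integral>\<^sup>+\<pi>. indicator B (S, \<pi>) \<partial>interaction k M A S)"
      using B by (simp add: emeasure_bind_prob_algebra[OF I_S return B])
    also have "\<dots> = (\<integral>\<^sup>+\<pi>. indicator {\<pi> \<in> space ?T. (S, \<pi>) \<in> B} \<pi> \<partial>interaction k M A S)"
      by (intro nn_integral_cong) (auto simp: sets_eq_imp_space_eq[OF sets] split: split_indicator)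
    also have "\<dots> = emeasure (interaction k M A S) {\<pi> \<in> space ?T. (S, \<pi>) \<in> B}"
      using B_S by (simp add: sets)
    finally show ?thesis .
  qed
  then show ?thesis
    unfolding sample_interaction_def by (simp add: emeasure_bind_prob_algebra[OF D kernel B])
qed

text \<open>The selected round varies with the transcript but takes finitely many values, and for
  each fixed value the map is a coordinate projection.\<close>

lemma measurable_transcript_query:
  assumes t: "t \<in> transcript_space k \<rightarrow>\<^sub>M count_space UNIV" and less: "\<And>\<pi>. t \<pi> < k"
  shows "(\<lambda>\<pi>. fst (\<pi> (t \<pi>))) \<in> transcript_space k \<rightarrow>\<^sub>M (query_space :: ('n, 'x) query measure)"
proof (rule measurable_compose_countable'[where I = "{..<k}"])
  show "(\<lambda>\<pi>. fst (\<pi> i)) \<in> transcript_space k \<rightarrow>\<^sub>M (query_space :: ('n, 'x) query measure)" if "i \<in> {..<k}" for i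
    unfolding transcript_space_def
    by (rule measurable_compose[OF measurable_component_singleton[OF that] measurable_fst])
  \<comment> \<open>The codomain shrinks to the rounds below \<open>k\<close>, the only coordinates
    of the product space.\<close>
  show "t \<in> transcript_space k \<rightarrow>\<^sub>M count_space {..<k}"
  proof (rule measurableI)
    fix X
    show "t -` X \<inter> space (transcript_space k) \<in> sets (transcript_space k)"
      by (rule measurable_sets[OF t]) simp
  qed (simp add: less)
qed simp

text \<open>Instantiates the kernel bound with the interaction. The measurability claim is there for
  the monotonicity and subadditivity steps that combine this event with inaccuracy on the
  sample.\<close>

lemma sample_interaction_query_tail:
  fixes M :: "('n::finite, 'x::countable, 's) mechanism"
  assumes M: "mechanism M" and A: "adversary A" and dp: "partial_dp k \<epsilon> 0 \<kappa> M"
    and g: "g \<in> transcript_space k \<rightarrow>\<^sub>M query_space" and \<tau>: "\<tau> > 0" and \<epsilon>: "\<epsilon> \<ge> 0"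
  shows "measure (sample_interaction k M A P)
      {(S, \<pi>) \<in> space (sample_interaction k M A P). \<tau> + (exp \<epsilon> - 1) + \<kappa> / real CARD('n)
        < \<bar>query_value (g \<pi>) S - query_mean (g \<pi>) P\<bar>}
    \<le> 2 * exp (- 2 * real CARD('n) * \<tau>\<^sup>2)"
    and "{(S, \<pi>) \<in> space (sample_interaction k M A P). \<tau> + (exp \<epsilon> - 1) + \<kappa> / real CARD('n)
        < \<bar>query_value (g \<pi>) S - query_mean (g \<pi>) P\<bar>} \<in> sets (sample_interaction k M A P)"
proof -
  let ?T = "transcript_space k :: ('n, 'x) transcript measure"
  let ?J = "sample_interaction k M A P"
  let ?bad = "\<lambda>S \<pi>. \<tau> + (exp \<epsilon> - 1) + \<kappa> / real CARD('n) < \<bar>query_value (g \<pi>) S - query_mean (g \<pi>) P\<bar>"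
  define B where "B = {(S, \<pi>) \<in> space ?J. ?bad S \<pi>}"
  have sets_J: "sets ?J = sets (count_space UNIV \<Otimes>\<^sub>M ?T)"
    using sample_interaction_prob_algebra[OF M A, of k P] by (simp add: space_prob_algebra)
  have space_J: "space ?J = UNIV \<times> space ?T"
    using sets_eq_imp_space_eq[OF sets_J] by (simp add: space_pair_measure)
  have "(\<lambda>(S, \<pi>). \<bar>query_value (g \<pi>) S - query_mean (g \<pi>) P\<bar>) \<in> borel_measurable (count_space UNIV \<Otimes>\<^sub>M ?T)"
  proof (rule measurable_pair_measure_countable1)
    fix S
    note [measurable] = measurable_compose[OF g measurable_query_value]
      measurable_compose[OF g measurable_query_mean]
    show "(\<lambda>\<pi>. case (S, \<pi>) of (S, \<pi>) \<Rightarrow> \<bar>query_value (g \<pi>) S - query_mean (g \<pi>) P\<bar>) \<in> borel_measurable ?T"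
      by simp measurable
  qed auto
  then have "{x \<in> space (count_space UNIV \<Otimes>\<^sub>M ?T). \<tau> + (exp \<epsilon> - 1) + \<kappa> / real CARD('n)
      < (\<lambda>(S, \<pi>). \<bar>query_value (g \<pi>) S - query_mean (g \<pi>) P\<bar>) x} \<in> sets (count_space UNIV \<Otimes>\<^sub>M ?T)"
    by (rule borel_measurable_less[OF borel_measurable_const])
  then have B: "B \<in> sets (count_space UNIV \<Otimes>\<^sub>M ?T)"
    by (simp add: B_def space_J space_pair_measure case_prod_unfold mem_Times_iff)
  then show "{(S, \<pi>) \<in> space ?J. ?bad S \<pi>} \<in> sets ?J" by (simp add: B_def sets_J)
  obtain fL :: "('n, 'x) transcript \<Rightarrow> 'n set" where
    fL: "fL \<in> ?T \<rightarrow>\<^sub>M count_space UNIV" "\<And>\<pi>. \<pi> \<in> space ?T \<Longrightarrow> real (card (fL \<pi>)) \<le> \<kappa>"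
      "\<And>i S S' E. \<lbrakk>\<forall>j. j \<noteq> i \<longrightarrow> S j = S' j; E \<in> sets ?T; i \<notin> (\<Union>\<pi>\<in>E. fL \<pi>)\<rbrakk> \<Longrightarrow>
        measure (interaction k M A S) E \<le> exp \<epsilon> * measure (interaction k M A S') E"
    using dp A unfolding partial_dp_def by (metis add.right_neutral)
  have "emeasure ?J B = (\<integral>\<^sup>+S. emeasure (interaction k M A S) {\<pi> \<in> space ?T. ?bad S \<pi>} \<partial>iid_sample P)"
    unfolding emeasure_sample_interaction[OF M A B] by (simp add: B_def space_J)
  also have "\<dots> \<le> ennreal (2 * exp (- 2 * real CARD('n) * \<tau>\<^sup>2))"
    by (rule private_kernel_tail[where fL = fL, OF interaction_prob_algebra[OF M A] fL g \<tau> \<epsilon>])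
  finally have "measure ?J B \<le> 2 * exp (- 2 * real CARD('n) * \<tau>\<^sup>2)"
    by (simp add: measure_def enn2real_leI)
  then show "measure ?J {(S, \<pi>) \<in> space ?J. ?bad S \<pi>} \<le> 2 * exp (- 2 * real CARD('n) * \<tau>\<^sup>2)"
    by (simp add: B_def)
qed

section \<open>From sample error to population error at the worst round\<close>

theorem theorem6:
  fixes M :: "('n::finite, 'x::countable, 's) mechanism"
    and A :: "('n, 'x) adversary"
    and P :: "'x pmf"
    and k :: nat
    and \<epsilon> \<kappa> \<alpha> \<beta> \<eta> :: real
  assumes "k > 0" and "\<epsilon> \<ge> 0" and "\<eta> > 0"
    and "mechanism M"
    and "partial_dp k \<epsilon> 0 \<kappa> M"
    and "sample_accurate k \<alpha> \<beta> M"
    and "adversary A"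
  shows "measure (sample_interaction k M A P)
           {(S, \<pi>) \<in> space (sample_interaction k M A P).
              max_error k (\<lambda>q. query_mean q P) \<pi>
                > \<alpha> + sqrt (2 * ln (2 / \<eta>) / real CARD('n)) + (exp \<epsilon> - 1) + \<kappa> / real CARD('n)}
         \<le> \<beta> + \<eta>"
proof -
  let ?T = "transcript_space k :: ('n, 'x) transcript measure"
  let ?J = "sample_interaction k M A P"
  have J: "?J \<in> space (prob_algebra (count_space UNIV \<Otimes>\<^sub>M ?T))"
    by (rule sample_interaction_prob_algebra) fact+
  then interpret J: prob_space ?J by (simp add: space_prob_algebra)
  have sets_J: "sets ?J = sets (count_space UNIV \<Otimes>\<^sub>M ?T)" using J by (simp add: space_prob_algebra)
  then have space_J: "space ?J = UNIV \<times> space ?T"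
    using sets_eq_imp_space_eq[OF sets_J] by (simp add: space_pair_measure)
  let ?acc = "{(S, \<pi>) \<in> space ?J. max_error k (\<lambda>q. query_value q S) \<pi> \<ge> \<alpha>}"
  have accurate: "measure ?J ?acc \<le> \<beta>"
    using assms by (simp add: sample_accurate_def)
  then have "\<beta> \<ge> 0" using measure_nonneg[of ?J ?acc] by linarith
  define \<tau> where "\<tau> = sqrt (2 * ln (2 / \<eta>) / real CARD('n))"
  show ?thesis
  \<comment> \<open>For \<open>\<eta> \<ge> 1\<close> the claimed bound is at least 1. For
    \<open>\<eta> < 1\<close> the logarithm is positive, which gives
    \<open>\<tau> > 0\<close>.\<close>
  proof (cases "\<eta> < 1")
    case False
    then show ?thesis using \<open>\<beta> \<ge> 0\<close> by (intro order_trans[OF J.prob_le_1]) simp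
  next
    case True
    let ?err = "\<lambda>\<pi> t. \<bar>snd (\<pi> t) - query_mean (fst (\<pi> t)) P\<bar>"
    let ?max = "max_error k (\<lambda>q. query_mean q P) :: ('n, 'x) transcript \<Rightarrow> real"
    \<comment> \<open>The first round attaining the maximal population error; taking the least such
      round makes the selection measurable. Working with this single query avoids a union bound over
      the rounds.\<close>
    define worst where "worst \<pi> = (LEAST t. t < k \<and> ?max \<pi> \<le> ?err \<pi> t)" for \<pi> :: "('n, 'x) transcript"
    have worst: "worst \<pi> < k \<and> ?max \<pi> \<le> ?err \<pi> (worst \<pi>)" for \<pi>
    proof -
      have "?max \<pi> \<in> ?err \<pi> ` {..<k}"
        unfolding max_error_def using \<open>k > 0\<close> by (intro Max_in) auto
      then have "\<exists>t. t < k \<and> ?max \<pi> \<le> ?err \<pi> t" by fastforce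
      then show ?thesis unfolding worst_def by (rule LeastI_ex)
    qed
    have "worst \<in> ?T \<rightarrow>\<^sub>M count_space UNIV"
      unfolding worst_def
    proof (rule measurable_Least)
      fix t
      note [measurable] = measurable_query_mean
      \<comment> \<open>The population error does not depend on the dataset, so the measurability
        lemma is used with a one-point index type.\<close>
      have "(\<lambda>(S :: unit, \<pi>). ?max \<pi>) \<in> borel_measurable (count_space UNIV \<Otimes>\<^sub>M ?T)"
        by (rule measurable_max_error) measurable
      from measurable_Pair_compose_split[OF this measurable_const measurable_ident]
      have max: "?max \<in> borel_measurable ?T" by simp
      show "Measurable.pred ?T (\<lambda>\<pi>. t < k \<and> ?max \<pi> \<le> ?err \<pi> t)"
      proof (cases "t < k")
        case True
        then have [measurable]: "(\<lambda>\<pi>. \<pi> t) \<in> ?T \<rightarrow>\<^sub>M (query_space \<Otimes>\<^sub>M borel)"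
          unfolding transcript_space_def by (intro measurable_component_singleton) simp
        have err: "(\<lambda>\<pi>. ?err \<pi> t) \<in> borel_measurable ?T" by measurable
        show ?thesis
          unfolding pred_def using True borel_measurable_le[OF max err] by simp
      qed simp
    qed
    then have g: "(\<lambda>\<pi>. fst (\<pi> (worst \<pi>))) \<in> ?T \<rightarrow>\<^sub>M query_space"
      using worst by (intro measurable_transcript_query) auto
    have "\<tau> > 0" using True \<open>\<eta> > 0\<close> by (simp add: \<tau>_def)
    let ?dev = "{(S, \<pi>) \<in> space ?J. \<tau> + (exp \<epsilon> - 1) + \<kappa> / real CARD('n)
        < \<bar>query_value (fst (\<pi> (worst \<pi>))) S - query_mean (fst (\<pi> (worst \<pi>))) P\<bar>}"
    note tail = sample_interaction_query_tail[OF \<open>mechanism M\<close> \<open>adversary A\<close>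
        \<open>partial_dp k \<epsilon> 0 \<kappa> M\<close> g \<open>\<tau> > 0\<close> \<open>\<epsilon> \<ge> 0\<close>, of P]
    \<comment> \<open>The exponent is four times what is needed: \<open>ln (2 / \<eta>)\<close>
      alone already gives \<eta>.\<close>
    have "2 * exp (- 2 * real CARD('n) * \<tau>\<^sup>2) = 2 * exp (- 4 * ln (2 / \<eta>))"
      using True \<open>\<eta> > 0\<close> by (simp add: \<tau>_def)
    also have "\<dots> \<le> 2 * exp (- ln (2 / \<eta>))" using True \<open>\<eta> > 0\<close> by simp
    also have "\<dots> = \<eta>" using \<open>\<eta> > 0\<close> by (simp add: exp_minus)
    finally have deviation: "measure ?J ?dev \<le> \<eta>" using tail(1) by linarith
    have "(\<lambda>(S, \<pi>). max_error k (\<lambda>q. query_value q S) \<pi>) \<in> borel_measurable (count_space UNIV \<Otimes>\<^sub>M ?T)"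
      by (rule measurable_max_error) (rule measurable_query_value)
    then have "{x \<in> space (count_space UNIV \<Otimes>\<^sub>M ?T).
        \<alpha> \<le> (\<lambda>(S, \<pi>). max_error k (\<lambda>q. query_value q S) \<pi>) x} \<in> sets (count_space UNIV \<Otimes>\<^sub>M ?T)"
      by (rule borel_measurable_le[OF borel_measurable_const])
    then have acc: "?acc \<in> sets ?J"
      by (simp add: sets_J space_J space_pair_measure case_prod_unfold mem_Times_iff)
    \<comment> \<open>Triangle inequality at the worst round: if every sample error is below
      \<alpha>, the excess must come from the gap between sample value and population mean.\<close>
    have "{(S, \<pi>) \<in> space ?J. ?max \<pi> > \<alpha> + \<tau> + (exp \<epsilon> - 1) + \<kappa> / real CARD('n)} \<subseteq> ?acc \<union> ?dev"
    proof
      fix x assume "x \<in> {(S, \<pi>) \<in> space ?J. ?max \<pi> > \<alpha> + \<tau> + (exp \<epsilon> - 1) + \<kappa> / real CARD('n)}"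
      then obtain S \<pi> where x: "x = (S, \<pi>)" "(S, \<pi>) \<in> space ?J"
        and large: "?max \<pi> > \<alpha> + \<tau> + (exp \<epsilon> - 1) + \<kappa> / real CARD('n)"
        by auto
      have "\<bar>snd (\<pi> (worst \<pi>)) - query_value (fst (\<pi> (worst \<pi>))) S\<bar> \<le> max_error k (\<lambda>q. query_value q S) \<pi>"
        unfolding max_error_def using worst[of \<pi>] by (intro Max_ge) auto
      then have "\<alpha> \<le> max_error k (\<lambda>q. query_value q S) \<pi> \<or> \<tau> + (exp \<epsilon> - 1) + \<kappa> / real CARD('n)
          < \<bar>query_value (fst (\<pi> (worst \<pi>))) S - query_mean (fst (\<pi> (worst \<pi>))) P\<bar>"
        using worst[of \<pi>] large by linarith
      then show "x \<in> ?acc \<union> ?dev" using x by auto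
    qed
    then have "measure ?J {(S, \<pi>) \<in> space ?J. ?max \<pi> > \<alpha> + \<tau> + (exp \<epsilon> - 1) + \<kappa> / real CARD('n)}
        \<le> measure ?J (?acc \<union> ?dev)"
      using acc tail(2) by (intro J.finite_measure_mono) auto
    also have "\<dots> \<le> measure ?J ?acc + measure ?J ?dev"
      using acc tail(2) by (rule measure_Un_le)
    finally show ?thesis using accurate deviation by (simp add: \<tau>_def)
  qed
qed

end
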